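(* There are infinitely many overlap-free words $w$ over the binary alphabet $\{0,1\}$ such that $M(w) = \left\lceil \frac{|w|}{2} \right\rceil + 1$, where $M(w)$ denotes the number of positions of $w$ that are centres of squares in $w$.
   Context: Words are finite words over the alphabet $\{0,1\}$, and $|w|$ denotes the length of $w$. A word $u$ is a factor of $w$ if $w = xuy$ for some (possibly empty) words $x, y$. An overlap is a word of the form $uvuvu$ where $u$ is a nonempty word ($v$ may be empty). A word is overlap-free if none of its factors is an overlap. A position in $w$ is an integer $p$ with $1 \le p < |w|$; it denotes the place after the prefix of length $p$. Write $w = xy$ with $|x| = p$. The position $p$ is a centre of a square in $w$ if there is a nonempty word $u$ and possibly empty words $x', y'$ such that $x = x'u$ and $y = uy'$. Define $M(w) = \#\{p \mid p \text{ is a centre of a square in } w\}$ (each position is counted at most once). *)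

theory Defs
  imports Complex_Main "HOL-Library.Sublist"
begin

(* The letters 0 and 1 of the binary alphabet are rendered by False and True; the definitions
   below make sense over any alphabet. *)
type_synonym binary_word = "bool list"

definition is_overlap :: "'a list \<Rightarrow> bool" where
  "is_overlap w \<longleftrightarrow> (\<exists>u v. u \<noteq> [] \<and> w = u @ v @ u @ v @ u)"

(* "sublist u w" is the library's factor relation (contiguous subword): w = x @ u @ y. *)
definition overlap_free :: "'a list \<Rightarrow> bool" where
  "overlap_free w \<longleftrightarrow> (\<forall>z. sublist z w \<longrightarrow> \<not> is_overlap z)"

definition square_centre :: "'a list \<Rightarrow> nat \<Rightarrow> bool" where
  "square_centre w p \<longleftrightarrow> 1 \<le> p \<and> p < length w \<and>
     (\<exists>x y. w = x @ y \<and> length x = p \<and>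
       (\<exists>u x' y'. u \<noteq> [] \<and> x = x' @ u \<and> y = u @ y'))"

definition num_square_centres :: "'a list \<Rightarrow> nat" where
  "num_square_centres w = card {p. square_centre w p}"

end

theory Submission
  imports Defs
begin

text \<open>
  In the Thue--Morse word, split into the blocks \<open>01\<close> and \<open>10\<close>, every block boundary is the centre
  of a square of period 1 or 2, while no other position is the centre of a square. A factor of
  \<open>n\<close> blocks therefore has \<open>n - 1\<close> centres. Flipping the first and the last letter of
  a factor \<open>101001 \<dots> 011010\<close> yields \<open>001001 \<dots> 011011\<close>, which destroys the square at the first
  block boundary and creates squares centred one letter before and one letter after it; the same
  happens at the last boundary. The net gain is 2, which gives \<open>n + 1\<close> centres. The flips create no
  overlap, since neither \<open>00100\<close> nor \<open>11011\<close> is a factor of the Thue--Morse word.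
\<close>

section \<open>Overlaps and square centres by position\<close>

text \<open>With \<open>q\<close> the length of \<open>u @ v\<close>, only the first letter of the
  last \<open>u\<close> is kept, which leaves \<open>2 * q + 1\<close> letters of period
  \<open>q\<close>.\<close>

lemma not_overlap_free_nth:
  assumes "\<not> overlap_free w"
  obtains s q where "q > 0" "s + 2 * q < length w" "\<And>i. i \<le> q \<Longrightarrow> w ! (s + i) = w ! (s + q + i)"
proof -
  obtain x u v y where u: "u \<noteq> []" and w: "w = x @ (u @ v @ u @ v @ u) @ y"
    using assms by (auto simp: overlap_free_def is_overlap_def sublist_def)
  let ?q = "length u + length v"
  have "w ! (length x + i) = w ! (length x + ?q + i)" if "i \<le> ?q" for i
  proof -
    have shift: "w ! (length x + ?q + i) = (u @ v @ u @ y) ! i"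
      using nth_append_length_plus[of "x @ u @ v" "u @ v @ u @ y" i] by (simp add: w add.assoc)
    have "w ! (length x + i) = (u @ v @ u @ v @ u @ y) ! i"
      using nth_append_length_plus[of x "u @ v @ u @ v @ u @ y" i] by (simp add: w)
    also have "\<dots> = (u @ v @ u @ y) ! i"
    proof (cases "i = ?q")
      case True
      then show ?thesis using u by (simp add: nth_append)
    next
      case False
      then show ?thesis using that by (auto simp: nth_append)
    qed
    finally show ?thesis using shift by simp
  qed
  moreover have "length x + 2 * ?q < length w" "?q > 0"
    using u by (simp_all add: w)
  ultimately show thesis using that by blast
qed

lemma square_centre_iff_nth:
  "square_centre w p \<longleftrightarrow>
     (\<exists>q. 0 < q \<and> q \<le> p \<and> p + q \<le> length w \<and> (\<forall>i<q. w ! (p - q + i) = w ! (p + i)))"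
  (is "_ \<longleftrightarrow> ?R")
proof
  assume "square_centre w p"
  then obtain u x' y' where u: "u \<noteq> []" and p: "p = length x' + length u"
    and w: "w = x' @ u @ u @ y'"
    by (auto simp: square_centre_def)
  have "w ! (p - length u + i) = w ! (p + i)" if "i < length u" for i
    using that nth_append_length_plus[of "x' @ u" "u @ y'" i]
    by (simp add: p w nth_append)
  then show ?R
    using u by (intro exI[of _ "length u"]) (auto simp: p w)
next
  assume ?R
  then obtain q where q: "0 < q" "q \<le> p" "p + q \<le> length w"
    and eq: "\<And>i. i < q \<Longrightarrow> w ! (p - q + i) = w ! (p + i)" by auto
  let ?u = "take q (drop p w)"
  have "drop (p - q) (take p w) = ?u"
    using q eq by (intro nth_equalityI) auto
  then have "take p w = take (p - q) (take p w) @ ?u"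
    using append_take_drop_id[of "p - q" "take p w"] by metis
  moreover have "drop p w = ?u @ drop q (drop p w)"
    by (rule append_take_drop_id[symmetric])
  moreover have "?u \<noteq> []" using q by auto
  moreover have "w = take p w @ drop p w" "length (take p w) = p" using q by auto
  moreover have "1 \<le> p" "p < length w" using q by auto
  ultimately show "square_centre w p"
    unfolding square_centre_def by blast
qed

section \<open>The Thue--Morse word\<close>

text \<open>The parity of the number of ones in the binary expansion of the index.\<close>

fun thue_morse :: "nat \<Rightarrow> bool" where
  "thue_morse n = (if n = 0 then False else thue_morse (n div 2) \<noteq> odd n)"

declare thue_morse.simps [simp del]

lemma thue_morse_double [simp]: "thue_morse (2 * n) = thue_morse n"
  by (cases "n = 0") (simp_all add: thue_morse.simps[of "2 * n"])

lemma thue_morse_Suc_double [simp]: "thue_morse (Suc (2 * n)) = (\<not> thue_morse n)"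
  by (simp add: thue_morse.simps[of "Suc (2 * n)"])

lemma thue_morse_Suc_even: "even n \<Longrightarrow> thue_morse (Suc n) = (\<not> thue_morse n)"
  by (auto elim!: evenE)

text \<open>The \<open>k\<close> lowest binary digits are those of \<open>r\<close>, the others
  those of \<open>n\<close>, so the digit-sum parities add.\<close>

lemma thue_morse_power_2_mult_add:
  "r < 2 ^ k \<Longrightarrow> thue_morse (2 ^ k * n + r) = (thue_morse n \<noteq> thue_morse r)"
proof (induction k arbitrary: r)
  case 0
  then show ?case by (simp add: thue_morse.simps[of 0])
next
  case (Suc k)
  show ?case
  proof (cases "even r")
    case True
    then obtain j where "r = 2 * j" by (rule evenE)
    then show ?thesis
      using Suc thue_morse_double[of "2 ^ k * n + j"] by (simp add: distrib_left mult.assoc)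
  next
    case False
    then obtain j where "r = Suc (2 * j)" by (auto elim: oddE)
    then show ?thesis
      using Suc thue_morse_Suc_double[of "2 ^ k * n + j"] by (simp add: distrib_left mult.assoc)
  qed
qed

text \<open>Neighbours in one block differ. Neighbours across a boundary differ too, since shifting
  by the odd period puts them into one block. After \<open>q\<close> changes, an odd number, the
  letters at \<open>s\<close> and \<open>s + q\<close> differ.\<close>

lemma thue_morse_no_odd_square:
  assumes "odd q" "even s" and eq: "\<And>i. i < q \<Longrightarrow> thue_morse (s + i) = thue_morse (s + q + i)"
  shows False
proof -
  have alternate: "thue_morse (s + Suc i) = (\<not> thue_morse (s + i))" if "i < q" for i
  proof (cases "even i")
    case True
    then show ?thesis using thue_morse_Suc_even[of "s + i"] \<open>even s\<close> by simp
  next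
    case False
    then have "Suc i < q"
      using that \<open>odd q\<close> by (cases "Suc i = q") auto
    then show ?thesis
      using eq[of i] eq[of "Suc i"] thue_morse_Suc_even[of "s + q + i"] False assms(1,2) by simp
  qed
  have "i \<le> q \<Longrightarrow> thue_morse (s + i) = (thue_morse s \<noteq> odd i)" for i
    by (induction i) (auto simp: alternate simp del: add_Suc_right)
  from this[of q] show False
    using eq[of 0] \<open>odd q\<close> by (simp add: odd_pos)
qed

text \<open>Sampling every second letter halves an even period. For an odd period, the overlap
  contains squares starting at \<open>s\<close> and at \<open>Suc s\<close>, one of which starts a
  block.\<close>

lemma thue_morse_overlap_free:
  assumes "q > 0" "\<And>i. i \<le> q \<Longrightarrow> thue_morse (s + i) = thue_morse (s + q + i)"
  shows False
  using assms
proof (induction q arbitrary: s rule: less_induct)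
  case (less q)
  show False
  proof (cases "even q")
    case True
    then obtain r where r: "q = 2 * r" by (rule evenE)
    have "thue_morse (s div 2 + i) = thue_morse (s div 2 + r + i)" if "i \<le> r" for i
    proof (cases "even s")
      case True
      then obtain k where "s = 2 * k" by (rule evenE)
      then show ?thesis
        using less.prems(2)[of "2 * i"] that thue_morse_double[of "k + i"]
          thue_morse_double[of "k + r + i"]
        by (simp add: r algebra_simps del: thue_morse_double)
    next
      case False
      then obtain k where "s = Suc (2 * k)" by (auto elim: oddE)
      then show ?thesis
        using less.prems(2)[of "2 * i"] that thue_morse_Suc_double[of "k + i"]
          thue_morse_Suc_double[of "k + r + i"]
        by (simp add: r algebra_simps del: thue_morse_Suc_double)
    qed
    then show False
      using less.IH[of r "s div 2"] less.prems(1) r by auto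
  next
    case odd: False
    show False
    proof (cases "even s")
      case True
      then show False
        using thue_morse_no_odd_square[of q s] odd less.prems(2) by auto
    next
      case False
      then show False
        using thue_morse_no_odd_square[of q "Suc s"] odd less.prems(2)[of "Suc _"] by auto
    qed
  qed
qed

text \<open>An odd period makes \<open>s\<close> even, the case already excluded. For an even
  period, the last letter of each half begins a block and so determines the letter after it.\<close>

lemma thue_morse_no_odd_centre:
  assumes "q > 0" "odd (s + q)"
    and eq: "\<And>i. i < q \<Longrightarrow> thue_morse (s + i) = thue_morse (s + q + i)"
  shows False
proof (cases "even q")
  case False
  then show False using thue_morse_no_odd_square assms by (meson even_add)
next
  case True
  \<comment> \<open>The square straddles block boundaries at both ends, so it extends to an overlap.\<close>
  have "thue_morse (s + q + q) = thue_morse (s + q)"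
    using thue_morse_Suc_even[of "s + q - 1"] thue_morse_Suc_even[of "s + q + q - 1"]
      eq[of "q - 1"] assms(1,2) True by simp
  then have "thue_morse (s + i) = thue_morse (s + q + i)" if "i \<le> q" for i
    using that eq[of i] eq[of 0] \<open>q > 0\<close> by (cases "i = q") auto
  then show False using thue_morse_overlap_free[of q s] \<open>q > 0\<close> by blast
qed

text \<open>The two pairs start at positions of opposite parity, so one of them is a block.\<close>

lemma thue_morse_no_xxyxx:
  assumes "thue_morse a = thue_morse (a + 1)" "thue_morse (a + 3) = thue_morse (a + 4)"
  shows False
  using assms thue_morse_Suc_even[of a] thue_morse_Suc_even[of "a + 3"]
  by (cases "even a") (simp_all add: add.commute[of a])

section \<open>The flipped factors\<close>

text \<open>For \<open>n\<close> with letter 0, the factor starting at position 2 of length \<open>32n + 28\<close>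
  has the required prefix and suffix.\<close>

definition flipped_letter :: "nat \<Rightarrow> nat \<Rightarrow> bool" where
  "flipped_letter n i =
     (if i = 0 then False else if i = 32 * n + 27 then True else thue_morse (i + 2))"

definition flipped_word :: "nat \<Rightarrow> binary_word" where
  "flipped_word n = map (flipped_letter n) [0..<32 * n + 28]"

lemma length_flipped_word [simp]: "length (flipped_word n) = 32 * n + 28"
  by (simp add: flipped_word_def)

lemma nth_flipped_word [simp]: "i < 32 * n + 28 \<Longrightarrow> flipped_word n ! i = flipped_letter n i"
  by (simp add: flipped_word_def del: upt_Suc)

lemma flipped_letter_inner:
  "0 < i \<Longrightarrow> i < 32 * n + 27 \<Longrightarrow> flipped_letter n i = thue_morse (i + 2)"
  by (simp add: flipped_letter_def)

lemma flipped_letter_prefix: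
  "\<not> flipped_letter n 0" "\<not> flipped_letter n 1" "flipped_letter n 2" "\<not> flipped_letter n 3"
  "\<not> flipped_letter n 4" "flipped_letter n 5" "flipped_letter n 6"
  by (simp_all add: flipped_letter_def thue_morse.simps)

lemma flipped_letter_suffix:
  assumes "\<not> thue_morse n"
  shows "flipped_letter n (32 * n + 27)" "flipped_letter n (32 * n + 26)"
    "\<not> flipped_letter n (32 * n + 25)" "flipped_letter n (32 * n + 24)"
    "flipped_letter n (32 * n + 23)" "\<not> flipped_letter n (32 * n + 22)"
    "\<not> flipped_letter n (32 * n + 21)"
proof -
  \<comment> \<open>The unflipped letters in question lie at Thue--Morse positions
    \<open>32 * n + r\<close> with \<open>r < 32\<close>.\<close>
  have "thue_morse (r + 32 * n) = thue_morse r" if "r < 32" for r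
    using thue_morse_power_2_mult_add[of r 5 n] that assms by (simp add: add.commute)
  then show "flipped_letter n (32 * n + 27)" "flipped_letter n (32 * n + 26)"
    "\<not> flipped_letter n (32 * n + 25)" "flipped_letter n (32 * n + 24)"
    "flipped_letter n (32 * n + 23)" "\<not> flipped_letter n (32 * n + 22)"
    "\<not> flipped_letter n (32 * n + 21)"
    by (simp_all add: flipped_letter_def thue_morse.simps[of "numeral _"]
        thue_morse.simps[of "Suc 0"] thue_morse.simps[of 0])
qed

text \<open>The words \<open>00100\<close> and \<open>11011\<close> occur only as the prefix and the suffix, respectively.\<close>

lemma flipped_letter_prefix_unique:
  assumes "0 < a" "a + 4 < 32 * n + 28"
    and eq: "\<And>i. i < 5 \<Longrightarrow> flipped_letter n i = flipped_letter n (a + i)"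
  shows False
proof -
  \<comment> \<open>The word \<open>00100\<close> ends in 0 but the last letter is 1, so the window
    avoids both flipped letters.\<close>
  have "a + 4 \<noteq> 32 * n + 27"
    using eq[of 4] flipped_letter_prefix(5)[of n] by (auto simp: flipped_letter_def)
  then have inner: "flipped_letter n (a + i) = thue_morse (a + 2 + i)" if "i < 5" for i
    using assms(1,2) that flipped_letter_inner[of "a + i" n] by (simp add: ac_simps)
  show False
    using thue_morse_no_xxyxx[of "a + 2"] flipped_letter_prefix[of n] inner[of 0] inner[of 1]
      inner[of 3] inner[of 4] eq[of 0] eq[of 1] eq[of 3] eq[of 4]
    by auto
qed

lemma flipped_letter_suffix_unique:
  assumes "\<not> thue_morse n" "a < 32 * n + 23"
    and eq: "\<And>i. i < 5 \<Longrightarrow> flipped_letter n (a + i) = flipped_letter n (32 * n + 23 + i)"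
  shows False
proof -
  note suffix = flipped_letter_suffix[OF assms(1)]
    flipped_letter_suffix[OF assms(1), unfolded add.commute[of "32 * n"]]
  have "a \<noteq> 0"
    using eq[of 0] suffix(5) flipped_letter_prefix(1)[of n] by (metis add.right_neutral zero_less_numeral)
  then have inner: "flipped_letter n (a + i) = thue_morse (a + 2 + i)" if "i < 5" for i
    using assms(2) that flipped_letter_inner[of "a + i" n] by (simp add: ac_simps)
  show False
    using thue_morse_no_xxyxx[of "a + 2"] suffix inner[of 0] inner[of 1]
      inner[of 3] inner[of 4] eq[of 0] eq[of 1] eq[of 3] eq[of 4]
    by (auto simp: add.assoc)
qed

text \<open>An overlap avoiding both ends lies in the Thue--Morse word. One touching an end repeats
  \<open>00100\<close> or \<open>11011\<close> if its period is at least 5; shorter periods fail on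
  the known end letters.\<close>

lemma overlap_free_flipped_word:
  assumes "\<not> thue_morse n"
  shows "overlap_free (flipped_word n)"
proof (rule ccontr)
  note prefix = flipped_letter_prefix[of n] and suffix = flipped_letter_suffix[OF assms]
    flipped_letter_suffix[OF assms, unfolded add.commute[of "32 * n"]]
  assume "\<not> overlap_free (flipped_word n)"
  then obtain s q where q: "q > 0" "s + 2 * q < 32 * n + 28"
    and "\<And>i. i \<le> q \<Longrightarrow> flipped_word n ! (s + i) = flipped_word n ! (s + q + i)"
    by (rule not_overlap_free_nth) auto
  then have eq: "flipped_letter n (s + i) = flipped_letter n (s + q + i)" if "i \<le> q" for i
    using that q nth_flipped_word[of "s + i" n] nth_flipped_word[of "s + q + i" n] by fastforce
  consider "s = 0" | "s + 2 * q = 32 * n + 27" | "s > 0" "s + 2 * q < 32 * n + 27"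
    using q by linarith
  then show False
  proof cases
    case 1
    show False
    proof (cases "q < 5")
      case True
      then have "q = 1 \<or> q = 2 \<or> q = 3 \<or> q = 4" using q by auto
      then show False
        using eq[of 0] eq[of 1] eq[of q] prefix 1 by (auto simp: numeral_2_eq_2)
    next
      case False
      then show False
        using flipped_letter_prefix_unique[of q n] q eq 1 by auto
    qed
  next
    case 2
    show False
    proof (cases "q < 5")
      case True
      then have "q = 1 \<or> q = 2 \<or> q = 3 \<or> q = 4" using q by auto
      then consider "q = 1" "s = 32 * n + 25" | "q = 2" "s = 32 * n + 23"
        | "q = 3" "s = 32 * n + 21" | "q = 4" "s = 32 * n + 19" using 2 by fastforce
      then show False
        by cases (use eq[of 0] eq[of q] eq[of "q - 1"] suffix in \<open>auto simp: add.assoc\<close>)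
    next
      case False
      \<comment> \<open>The five letters ending at the middle position \<open>s + q\<close> reappear
        as the last five letters of the word.\<close>
      have "flipped_letter n (s + q - 4 + i) = flipped_letter n (32 * n + 23 + i)" if "i < 5" for i
      proof -
        have "s + (q - 4 + i) = s + q - 4 + i" "s + q + (q - 4 + i) = 32 * n + 23 + i"
          using 2 False by auto
        then show ?thesis using eq[of "q - 4 + i"] that False by fastforce
      qed
      moreover have "s + q - 4 < 32 * n + 23" using 2 False by linarith
      ultimately show False
        using flipped_letter_suffix_unique assms by blast
    qed
  next
    case 3
    have "thue_morse (s + 2 + i) = thue_morse (s + 2 + q + i)" if "i \<le> q" for i
      using eq[OF that] 3 that q flipped_letter_inner[of "s + i" n]
        flipped_letter_inner[of "s + q + i" n]
      by (simp add: ac_simps)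
    then show False using thue_morse_overlap_free q(1) by blast
  qed
qed

section \<open>Square centres of the flipped words\<close>

lemma square_centre_flipped_word_iff:
  "square_centre (flipped_word n) p \<longleftrightarrow>
     (\<exists>q. 0 < q \<and> q \<le> p \<and> p + q \<le> 32 * n + 28 \<and>
       (\<forall>i<q. flipped_letter n (p - q + i) = flipped_letter n (p + i)))"
  by (auto simp: square_centre_iff_nth)

text \<open>Equal neighbouring blocks give period 2, opposite ones period 1. The bounds on
  \<open>j\<close> keep both blocks clear of the flipped letters.\<close>

lemma square_centre_flipped_word_even:
  assumes "2 \<le> j" "j \<le> 16 * n + 12"
  shows "square_centre (flipped_word n) (2 * j)"
proof -
  obtain k where j: "j = k + 2" using assms(1) by (metis le_add_diff_inverse2)
  have letters: "flipped_letter n (2 * k + 2) = thue_morse (k + 2)"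
    "flipped_letter n (2 * k + 3) = (\<not> thue_morse (k + 2))"
    "flipped_letter n (2 * k + 4) = thue_morse (k + 3)"
    "flipped_letter n (2 * k + 5) = (\<not> thue_morse (k + 3))"
    using assms thue_morse_double[of "k + 2"] thue_morse_Suc_double[of "k + 2"]
      thue_morse_double[of "k + 3"] thue_morse_Suc_double[of "k + 3"]
    by (simp_all add: j flipped_letter_inner eval_nat_numeral)
  show ?thesis
  proof (cases "thue_morse (k + 2) = thue_morse (k + 3)")
    case True
    then have "flipped_letter n (2 * j - 2 + i) = flipped_letter n (2 * j + i)" if "i < 2" for i
      using that letters True by (cases i) (simp_all add: j eval_nat_numeral)
    then show ?thesis
      unfolding square_centre_flipped_word_iff using assms by (intro exI[of _ 2]) auto
  next
    case False
    then have "flipped_letter n (2 * j - 1) = flipped_letter n (2 * j)"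
      using letters by (simp add: j eval_nat_numeral)
    then show ?thesis
      unfolding square_centre_flipped_word_iff using assms by (intro exI[of _ 1]) auto
  qed
qed

text \<open>These come from \<open>00\<close> and \<open>001001\<close> at the left end and from
  \<open>011011\<close> and \<open>11\<close> at the right end.\<close>

lemma square_centres_flipped_word_outer:
  assumes "\<not> thue_morse n"
  shows "square_centre (flipped_word n) 1" "square_centre (flipped_word n) 3"
    "square_centre (flipped_word n) (32 * n + 25)" "square_centre (flipped_word n) (32 * n + 27)"
proof -
  note prefix = flipped_letter_prefix[of n] and suffix = flipped_letter_suffix[OF assms]
    flipped_letter_suffix[OF assms, unfolded add.commute[of "32 * n"]]
  have less_3: "i < 3 \<longleftrightarrow> i = 0 \<or> i = 1 \<or> i = 2" for i :: nat by auto
  show "square_centre (flipped_word n) 1" "square_centre (flipped_word n) (32 * n + 27)"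
    unfolding square_centre_flipped_word_iff
    by (intro exI[of _ 1]; use prefix suffix in simp)+
  show "square_centre (flipped_word n) 3" "square_centre (flipped_word n) (32 * n + 25)"
    unfolding square_centre_flipped_word_iff
    by (intro exI[of _ 3]; use prefix suffix in \<open>auto simp: less_3 add.assoc\<close>)+
qed

lemma square_centre_flipped_word_cases:
  assumes "\<not> thue_morse n" "square_centre (flipped_word n) p"
  shows "p \<in> {1, 3, 32 * n + 25, 32 * n + 27} \<union> (*) 2 ` {2..16 * n + 12}"
proof -
  note prefix = flipped_letter_prefix[of n] and suffix = flipped_letter_suffix[OF assms(1)]
    flipped_letter_suffix[OF assms(1), unfolded add.commute[of "32 * n"]]
  obtain q where q: "0 < q" "q \<le> p" "p + q \<le> 32 * n + 28"
    and eq: "\<And>i. i < q \<Longrightarrow> flipped_letter n (p - q + i) = flipped_letter n (p + i)"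
    using assms(2) unfolding square_centre_flipped_word_iff by auto
  show ?thesis
  proof (cases "even p")
    case True
    then obtain j where j: "p = 2 * j" by (rule evenE)
    \<comment> \<open>At the first and the last block boundary only two letters are available on one
      side, so \<open>q\<close> is at most 2.\<close>
    have "p \<noteq> 2"
    proof
      assume "p = 2"
      then have "q = 1 \<or> q = 2" using q by auto
      then show False using eq[of 0] prefix \<open>p = 2\<close> by auto
    qed
    moreover have "p \<noteq> 32 * n + 26"
    proof
      assume p: "p = 32 * n + 26"
      then have "q = 1 \<or> q = 2" using q by auto
      then show False using eq[of 0] eq[of 1] suffix p by (auto simp: add.assoc)
    qed
    ultimately have "j \<noteq> 1" "j \<noteq> 16 * n + 13" "0 < j" "j < 16 * n + 14"
      using q by (auto simp: j)
    then have "j \<in> {2..16 * n + 12}" by auto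
    then show ?thesis by (auto simp: j)
  next
    case odd: False
    have "p \<in> {1, 3, 32 * n + 25, 32 * n + 27}"
    proof (rule ccontr)
      assume "p \<notin> {1, 3, 32 * n + 25, 32 * n + 27}"
      \<comment> \<open>Each side of \<open>p\<close> now has at least 5 letters, so a square
        reaching an end has a period of at least 5 and repeats \<open>00100\<close> or
        \<open>11011\<close>.\<close>
      then have p: "5 \<le> p" "p \<le> 32 * n + 23"
        using odd q by (auto, presburger+)
      consider "q = p" | "p + q = 32 * n + 28" | "q < p" "p + q < 32 * n + 28"
        using q by linarith
      then show False
      proof cases
        case 1
        then show False
          using flipped_letter_prefix_unique[of p n] p q eq by auto
      next
        case 2
        have "flipped_letter n (p - 5 + i) = flipped_letter n (32 * n + 23 + i)" if "i < 5" for i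
        proof -
          have "p - q + (q - 5 + i) = p - 5 + i" "p + (q - 5 + i) = 32 * n + 23 + i"
            using 2 p q by auto
          then show ?thesis using eq[of "q - 5 + i"] that 2 p by fastforce
        qed
        moreover have "p - 5 < 32 * n + 23" using p by linarith
        ultimately show False
          using flipped_letter_suffix_unique assms(1) by blast
      next
        case 3
        have "thue_morse (p - q + 2 + i) = thue_morse (p - q + 2 + q + i)" if "i < q" for i
          using eq[OF that] 3 that flipped_letter_inner[of "p - q + i" n]
            flipped_letter_inner[of "p + i" n]
          by (simp add: ac_simps)
        then show False
          using thue_morse_no_odd_centre[of q "p - q + 2"] q odd by auto
      qed
    qed
    then show ?thesis by blast
  qed
qed

text \<open>Four odd centres and the \<open>16 * n + 11\<close> even ones from 4 to
  \<open>32 * n + 24\<close>; half the length is \<open>16 * n + 14\<close>.\<close>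

lemma num_square_centres_flipped_word:
  assumes "\<not> thue_morse n"
  shows "num_square_centres (flipped_word n) = 16 * n + 15"
proof -
  let ?O = "{1, 3, 32 * n + 25, 32 * n + 27}" and ?E = "(*) 2 ` {2..16 * n + 12}"
  have "{p. square_centre (flipped_word n) p} = ?O \<union> ?E"
    using square_centre_flipped_word_cases[OF assms] square_centre_flipped_word_even[of _ n]
      square_centres_flipped_word_outer[OF assms] by auto
  moreover have "card (?O \<union> ?E) = card ?O + card ?E"
    by (rule card_Un_disjoint) (auto, presburger+)
  moreover have "card ?E = 16 * n + 11"
    by (subst card_image) (auto simp: inj_on_def)
  ultimately show ?thesis
    by (simp add: num_square_centres_def)
qed

theorem theorem5:
  shows "infinite {w :: binary_word. overlap_free w \<and>
           int (num_square_centres w) = \<lceil>real (length w) / 2\<rceil> + 1}"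
    (is "infinite ?S")
proof
  assume finite: "finite ?S"
  \<comment> \<open>Exactly one of \<open>2 * m\<close> and \<open>2 * m + 1\<close> carries the
    letter 0; halving it recovers \<open>m\<close>, which gives injectivity.\<close>
  define n where "n m = 2 * m + (if thue_morse m then 1 else 0)" for m
  have "\<not> thue_morse (n m)" for m
    by (simp add: n_def)
  moreover have "\<lceil>real (32 * k + 28) / 2\<rceil> = int (16 * k + 14)" for k
    by (rule ceiling_unique) auto
  ultimately have "flipped_word (n m) \<in> ?S" for m
    using overlap_free_flipped_word num_square_centres_flipped_word by simp
  then have "finite (range (\<lambda>m. flipped_word (n m)))"
    by (intro finite_subset[OF _ finite]) blast
  moreover have "inj (\<lambda>m. flipped_word (n m))"
  proof (rule injI)
    fix k m
    assume "flipped_word (n k) = flipped_word (n m)"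
    then have "32 * n k + 28 = 32 * n m + 28"
      by (metis length_flipped_word)
    then have "n k div 2 = n m div 2" by simp
    then show "k = m" by (simp add: n_def split: if_splits)
  qed
  ultimately show False
    using finite_imageD infinite_UNIV_nat by blast
qed

end
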